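(* Let $Y$ be a nonempty closed subset of a compact metrizable space $X$, and let $\ast$ be the \L ukasiewicz t-norm. Then any fuzzy metric on $Y$ can be extended over $X$; that is, for every fuzzy metric $M$ on $Y$ with respect to $\ast$ that generates the (subspace) topology of $Y$, there exists a fuzzy metric $M'$ on $X$ with respect to $\ast$ that generates the topology of $X$ and satisfies $M'(x,y,t)=M(x,y,t)$ for all $x,y\in Y$ and $t>0$.
   Context: The \L ukasiewicz t-norm is $x\ast y=\max\{x+y-1,0\}$ for $x,y\in[0,1]$. A fuzzy metric (in the sense of George and Veeramani) with respect to $\ast$ on a set $Z$ is a function $N\colon Z\times Z\times(0,\infty)\to[0,1]$ such that for all $x,y,z\in Z$ and $s,t>0$: (i) $N(x,y,t)>0$; (ii) $N(x,y,t)=1$ if and only if $x=y$; (iii) $N(x,y,t)=N(y,x,t)$; (iv) $N(x,y,t)\ast N(y,z,s)\le N(x,z,t+s)$; (v) $N(x,y,-)\colon(0,\infty)\to(0,1]$ is continuous. The open balls $\{y\in Z\mid N(x,y,t)>1-r\}$, $x\in Z$, $r\in(0,1)$, $t>0$, form a base of a (metrizable) topology $\tau_N$ on $Z$, the topology generated by $N$. Convention: a fuzzy metric on a topological space is always assumed to generate the given topology of the space. *)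

theory Defs
  imports "HOL-Analysis.Analysis"
begin

definition luk_tnorm :: "real \<Rightarrow> real \<Rightarrow> real"
  where "luk_tnorm x y = max (x + y - 1) 0"

text \<open>Fuzzy metrics in the sense of George and Veeramani, with respect to the Lukasiewicz t-norm.
  Functions are total in HOL: only the values \<open>N x y t\<close> with \<open>x, y \<in> Z\<close> and \<open>t > 0\<close> matter.\<close>

definition fuzzy_metric :: "'a set \<Rightarrow> ('a \<Rightarrow> 'a \<Rightarrow> real \<Rightarrow> real) \<Rightarrow> bool"
  where "fuzzy_metric Z N \<longleftrightarrow>
    (\<forall>x\<in>Z. \<forall>y\<in>Z. \<forall>t>0. N x y t \<in> {0..1}) \<and>
    (\<forall>x\<in>Z. \<forall>y\<in>Z. \<forall>t>0. N x y t > 0) \<and>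
    (\<forall>x\<in>Z. \<forall>y\<in>Z. \<forall>t>0. N x y t = 1 \<longleftrightarrow> x = y) \<and>
    (\<forall>x\<in>Z. \<forall>y\<in>Z. \<forall>t>0. N x y t = N y x t) \<and>
    (\<forall>x\<in>Z. \<forall>y\<in>Z. \<forall>z\<in>Z. \<forall>s>0. \<forall>t>0.
        luk_tnorm (N x y t) (N y z s) \<le> N x z (t + s)) \<and>
    (\<forall>x\<in>Z. \<forall>y\<in>Z. continuous_on {0<..} (N x y))"

definition fuzzy_ball :: "'a set \<Rightarrow> ('a \<Rightarrow> 'a \<Rightarrow> real \<Rightarrow> real) \<Rightarrow> 'a \<Rightarrow> real \<Rightarrow> real \<Rightarrow> 'a set"
  where "fuzzy_ball Z N x r t = {y\<in>Z. N x y t > 1 - r}"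

definition is_fuzzy_ball :: "'a set \<Rightarrow> ('a \<Rightarrow> 'a \<Rightarrow> real \<Rightarrow> real) \<Rightarrow> 'a set \<Rightarrow> bool"
  where "is_fuzzy_ball Z N B \<longleftrightarrow>
    (\<exists>x\<in>Z. \<exists>r\<in>{0<..<1}. \<exists>t>0. B = fuzzy_ball Z N x r t)"

text \<open>The topology having the open balls as a base. \<open>openin_fuzzy_topology\<close> below shows that this
  is indeed a topology when \<open>N\<close> is a fuzzy metric, so that \<open>topology\<close> is not applied to junk.\<close>

definition fuzzy_topology :: "'a set \<Rightarrow> ('a \<Rightarrow> 'a \<Rightarrow> real \<Rightarrow> real) \<Rightarrow> 'a topology"
  where "fuzzy_topology Z N = topology (arbitrary union_of is_fuzzy_ball Z N)"

lemma fuzzy_metric_triangle: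
  assumes "fuzzy_metric Z N" "x \<in> Z" "y \<in> Z" "z \<in> Z" "s > 0" "t > 0"
  shows "luk_tnorm (N x y t) (N y z s) \<le> N x z (t + s)"
  using assms unfolding fuzzy_metric_def by blast

lemma fuzzy_metric_self:
  assumes "fuzzy_metric Z N" "x \<in> Z" "t > 0"
  shows "N x x t = 1"
  using assms unfolding fuzzy_metric_def by blast

lemma fuzzy_metric_mono:
  assumes N: "fuzzy_metric Z N" and "x \<in> Z" "y \<in> Z" "0 < s" "s \<le> t"
  shows "N x y s \<le> N x y t"
proof (cases "s = t")
  case False
  then have "luk_tnorm (N x y s) (N y y (t - s)) \<le> N x y (s + (t - s))"
    using assms by (intro fuzzy_metric_triangle[OF N]) auto
  moreover have "N y y (t - s) = 1"
    using assms False by (intro fuzzy_metric_self[OF N]) auto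
  ultimately show ?thesis by (simp add: luk_tnorm_def)
qed simp

lemma fuzzy_ball_inside:
  assumes N: "fuzzy_metric Z N" and x: "x \<in> Z" and t: "t > 0" and y: "y \<in> fuzzy_ball Z N x r t"
  obtains e where "e > 0" "e < 1"
    "\<And>q u. 0 < q \<Longrightarrow> q \<le> e \<Longrightarrow> 0 < u \<Longrightarrow> u \<le> e \<Longrightarrow> fuzzy_ball Z N y q u \<subseteq> fuzzy_ball Z N x r t"
proof -
  have yZ: "y \<in> Z" and gt: "N x y t > 1 - r" using y by (auto simp: fuzzy_ball_def)
  define k where "k = N x y t - (1 - r)"
  have k: "k > 0" using gt by (simp add: k_def)
  have "continuous_on {0<..} (N x y)" using N x yZ unfolding fuzzy_metric_def by blast
  then have "\<exists>d>0. \<forall>s\<in>{0<..}. dist s t < d \<longrightarrow> dist (N x y s) (N x y t) < k / 2"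
    using t k unfolding continuous_on_iff
    by (elim ballE[of _ _ t] allE[of _ "k / 2"]) auto
  then obtain d where d: "d > 0" "\<And>s. s > 0 \<Longrightarrow> dist s t < d \<Longrightarrow> dist (N x y s) (N x y t) < k / 2"
    by auto
  define e where "e = min (min (d / 2) (t / 2)) (min (k / 2) (1 / 2))"
  have e: "e > 0" "e < 1" "e < d" "e < t" "e \<le> k / 2" using d(1) k t unfolding e_def by linarith+
  have s: "N x y (t - e) > 1 - r + k / 2"
  proof -
    have "\<bar>N x y (t - e) - N x y t\<bar> < k / 2"
      using d(2)[of "t - e"] e by (simp add: dist_real_def)
    then show ?thesis unfolding k_def by argo
  qed
  have "fuzzy_ball Z N y q u \<subseteq> fuzzy_ball Z N x r t" if q: "0 < q" "q \<le> e" "0 < u" "u \<le> e" for q u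
  proof
    fix z assume z: "z \<in> fuzzy_ball Z N y q u"
    then have zZ: "z \<in> Z" and "N y z u > 1 - q" by (auto simp: fuzzy_ball_def)
    moreover have "N y z u \<le> N y z e" using fuzzy_metric_mono[OF N yZ zZ] q by simp
    moreover have "luk_tnorm (N x y (t - e)) (N y z e) \<le> N x z ((t - e) + e)"
      using x yZ zZ e by (intro fuzzy_metric_triangle[OF N]) auto
    ultimately show "z \<in> fuzzy_ball Z N x r t"
      using s q e by (simp add: fuzzy_ball_def luk_tnorm_def)
  qed
  with e show ?thesis using that by blast
qed

lemma fuzzy_ball_centre: "\<lbrakk>fuzzy_metric Z N; x \<in> Z; r > 0; t > 0\<rbrakk> \<Longrightarrow> x \<in> fuzzy_ball Z N x r t"
  by (simp add: fuzzy_metric_self fuzzy_ball_def)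

lemma openin_fuzzy_topology:
  assumes N: "fuzzy_metric Z N"
  shows "openin (fuzzy_topology Z N) = arbitrary union_of is_fuzzy_ball Z N"
proof -
  have "(arbitrary union_of is_fuzzy_ball Z N) (S \<inter> T)"
    if S: "is_fuzzy_ball Z N S" and T: "is_fuzzy_ball Z N T" for S T
  proof -
    have "\<exists>U. is_fuzzy_ball Z N U \<and> y \<in> U \<and> U \<subseteq> S \<inter> T" if y: "y \<in> S \<inter> T" for y
    proof -
      obtain x r t where x: "x \<in> Z" "t > 0" "S = fuzzy_ball Z N x r t"
        using S by (auto simp: is_fuzzy_ball_def)
      obtain x' r' t' where x': "x' \<in> Z" "t' > 0" "T = fuzzy_ball Z N x' r' t'"
        using T by (auto simp: is_fuzzy_ball_def)
      obtain e where e: "e > 0" "e < 1"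
        "\<And>q u. 0 < q \<Longrightarrow> q \<le> e \<Longrightarrow> 0 < u \<Longrightarrow> u \<le> e \<Longrightarrow> fuzzy_ball Z N y q u \<subseteq> S"
        using fuzzy_ball_inside[OF N x(1,2), of y r] y unfolding x(3) by blast
      obtain e' where e': "e' > 0" "e' < 1"
        "\<And>q u. 0 < q \<Longrightarrow> q \<le> e' \<Longrightarrow> 0 < u \<Longrightarrow> u \<le> e' \<Longrightarrow> fuzzy_ball Z N y q u \<subseteq> T"
        using fuzzy_ball_inside[OF N x'(1,2), of y r'] y unfolding x'(3) by blast
      define m where "m = min e e'"
      have m: "0 < m" "m < 1" "m \<le> e" "m \<le> e'" using e e' by (auto simp: m_def)
      have yZ: "y \<in> Z" using y x(3) by (auto simp: fuzzy_ball_def)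
      have "is_fuzzy_ball Z N (fuzzy_ball Z N y m m)"
        unfolding is_fuzzy_ball_def
        using yZ m by (intro bexI[of _ y] bexI[of _ m] exI[of _ m]) simp_all
      moreover have "y \<in> fuzzy_ball Z N y m m"
        using fuzzy_ball_centre[OF N yZ] m by simp
      ultimately show ?thesis using e(3)[of m m] e'(3)[of m m] m by blast
    qed
    then show ?thesis by (simp add: arbitrary_union_of_alt)
  qed
  then have "istopology (arbitrary union_of is_fuzzy_ball Z N)"
    by (simp add: istopology_base_eq)
  then show ?thesis by (simp add: fuzzy_topology_def topology_inverse')
qed

end

theory Submission
  imports Defs
begin

text \<open>
  Write \<open>d = 1 - M\<close>, so that the fuzzy triangle inequality reads \<open>d(x,z,t+s) \<le> d(x,y,t) + d(y,z,s)\<close>.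
  By compactness of \<open>Y\<close>, the functions \<open>d(a,-,s)\<close> with \<open>a \<in> Y\<close> and \<open>s \<ge> t\<close> are uniformly
  equicontinuous with respect to a metric \<open>\<rho>\<close> of the space. A concave common modulus of continuity,
  composed with \<open>\<rho>\<close>, is a pseudometric \<open>g\<^sub>t < 1\<close> on the whole space for which each \<open>d(a,-,t)\<close> is
  1-Lipschitz on \<open>Y\<close>, and \<open>g\<^sub>t\<close> is nonincreasing in \<open>t\<close>. After making \<open>g\<^sub>t\<close> separate points, glue:
  the extension of \<open>d\<close> is the minimum of \<open>g\<^sub>t(x,y)\<close> and
  the infimum of \<open>g\<^sub>t(x,a) + d(a,b,t) + g\<^sub>t(b,y)\<close> over \<open>a, b \<in> Y\<close>. All three summands are taken at the same
  time \<open>t\<close>: the Lipschitz property lets a detour outside \<open>Y\<close> be absorbed without spending time.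
\<close>

section \<open>Uniform estimates for fuzzy metrics on compact spaces\<close>

text \<open>Since \<open>Q\<close> passes to smaller constants, the least of the local constants
  over a finite subcover works at every point.\<close>

lemma compact_space_uniform:
  fixes Q :: "'b \<Rightarrow> real \<Rightarrow> bool"
  assumes T: "compact_space T"
    and loc: "\<And>p. p \<in> topspace T \<Longrightarrow> \<exists>U e. openin T U \<and> p \<in> U \<and> e > 0 \<and> (\<forall>q\<in>U. Q q e)"
    and mono: "\<And>q e e'. Q q e \<Longrightarrow> 0 < e' \<Longrightarrow> e' \<le> e \<Longrightarrow> Q q e'"
  shows "\<exists>e>0. \<forall>q\<in>topspace T. Q q e"
proof -
  define \<U> where "\<U> = {U. openin T U \<and> (\<exists>e>0. \<forall>q\<in>U. Q q e)}"
  have "\<forall>U\<in>\<U>. openin T U" "topspace T \<subseteq> \<Union>\<U>"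
    using loc unfolding \<U>_def by blast+
  then obtain \<F> where \<F>: "finite \<F>" "\<F> \<subseteq> \<U>" "topspace T \<subseteq> \<Union>\<F>"
    using T unfolding compact_space_alt by meson
  have "\<forall>U\<in>\<F>. \<exists>e>0. \<forall>q\<in>U. Q q e" using \<F>(2) by (auto simp: \<U>_def)
  then obtain e where e: "\<And>U. U \<in> \<F> \<Longrightarrow> e U > 0" "\<And>U q. U \<in> \<F> \<Longrightarrow> q \<in> U \<Longrightarrow> Q q (e U)"
    by metis
  \<comment> \<open>The inserted 1 keeps the set nonempty when the subcover is empty.\<close>
  define m where "m = Min (insert 1 (e ` \<F>))"
  have m: "m > 0" "\<And>U. U \<in> \<F> \<Longrightarrow> m \<le> e U" using \<F>(1) e(1) by (auto simp: m_def)
  have "Q q m" if "q \<in> topspace T" for q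
    using that \<F>(3) e(2) mono m by blast
  with m(1) show ?thesis by blast
qed

text \<open>Compactness of the square, with the local hypothesis stated on rectangles so that
  applications deal only with neighbourhoods in \<open>T\<close>.\<close>

lemma compact_space_uniform_pairs:
  fixes Q :: "'b \<Rightarrow> 'b \<Rightarrow> real \<Rightarrow> bool"
  assumes T: "compact_space T"
    and loc: "\<And>a b. a \<in> topspace T \<Longrightarrow> b \<in> topspace T \<Longrightarrow>
      \<exists>U V e. openin T U \<and> a \<in> U \<and> openin T V \<and> b \<in> V \<and> e > 0 \<and> (\<forall>x\<in>U. \<forall>y\<in>V. Q x y e)"
    and mono: "\<And>x y e e'. Q x y e \<Longrightarrow> 0 < e' \<Longrightarrow> e' \<le> e \<Longrightarrow> Q x y e'"
  shows "\<exists>e>0. \<forall>x\<in>topspace T. \<forall>y\<in>topspace T. Q x y e"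
proof -
  have "\<exists>e>0. \<forall>q\<in>topspace (prod_topology T T). (\<lambda>(x,y). Q x y) q e"
  proof (rule compact_space_uniform)
    show "compact_space (prod_topology T T)" using T by (simp add: compact_space_prod_topology)
    fix p assume "p \<in> topspace (prod_topology T T)"
    then obtain a b where p: "p = (a,b)" "a \<in> topspace T" "b \<in> topspace T" by auto
    obtain U V e where "openin T U" "a \<in> U" "openin T V" "b \<in> V" "e > 0" "\<forall>x\<in>U. \<forall>y\<in>V. Q x y e"
      using loc[OF p(2,3)] by blast
    then show "\<exists>U e. openin (prod_topology T T) U \<and> p \<in> U \<and> e > 0 \<and> (\<forall>q\<in>U. (\<lambda>(x,y). Q x y) q e)"
      by (intro exI[of _ "U \<times> V"] exI[of _ e]) (auto simp: openin_prod_Times_iff p(1))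
  qed (use mono in auto)
  then show ?thesis by auto
qed

section \<open>The topology generated by a fuzzy metric\<close>

lemma openin_fuzzy_ball:
  assumes "fuzzy_metric Z N" "x \<in> Z" "0 < r" "r < 1" "0 < t"
  shows "openin (fuzzy_topology Z N) (fuzzy_ball Z N x r t)"
proof -
  have "is_fuzzy_ball Z N (fuzzy_ball Z N x r t)"
    using assms unfolding is_fuzzy_ball_def by (intro bexI[of _ x] bexI[of _ r] exI[of _ t]) auto
  then show ?thesis
    using openin_fuzzy_topology[OF assms(1)] by (simp add: union_of_inc arbitrary_def)
qed

lemma topspace_fuzzy_topology:
  assumes "fuzzy_metric Z N"
  shows "topspace (fuzzy_topology Z N) = Z"
proof
  show "topspace (fuzzy_topology Z N) \<subseteq> Z"
    using openin_topspace[of "fuzzy_topology Z N"] unfolding openin_fuzzy_topology[OF assms]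
    by (fastforce simp: union_of_def is_fuzzy_ball_def fuzzy_ball_def)
  show "Z \<subseteq> topspace (fuzzy_topology Z N)"
    using openin_subset[OF openin_fuzzy_ball[OF assms, of _ "1/2" 1]] fuzzy_ball_centre[OF assms, of _ "1/2" 1]
    by fastforce
qed

lemma Hausdorff_fuzzy_topology:
  assumes N: "fuzzy_metric Z N"
  shows "Hausdorff_space (fuzzy_topology Z N)"
  unfolding Hausdorff_space_def topspace_fuzzy_topology[OF N]
proof (intro allI impI, elim conjE)
  fix x y assume xy: "x \<in> Z" "y \<in> Z" "x \<noteq> y"
  \<comment> \<open>A common point of the two balls at time 1 would give
    \<open>N x y (1 + 1) > 1 - 2 * r\<close>, whereas this choice of \<open>r\<close> makes the two
    sides equal.\<close>
  define r where "r = (1 - N x y 2) / 2"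
  have "N x y 2 \<noteq> 1" "N x y 2 \<in> {0..1}" "N x y 2 > 0"
    using N xy unfolding fuzzy_metric_def by simp_all
  then have r: "0 < r" "r < 1" by (auto simp: r_def)
  have "disjnt (fuzzy_ball Z N x r 1) (fuzzy_ball Z N y r 1)"
  proof (clarsimp simp: disjnt_iff fuzzy_ball_def)
    fix z assume z: "z \<in> Z" "1 - r < N x z 1" "1 - r < N y z 1"
    have "luk_tnorm (N x z 1) (N z y 1) \<le> N x y (1 + 1)"
      using xy z by (intro fuzzy_metric_triangle[OF N]) auto
    moreover have "N z y 1 = N y z 1" using N xy z unfolding fuzzy_metric_def by simp
    moreover have "N x y 2 = 1 - 2 * r" by (simp add: r_def field_simps)
    ultimately show False using z by (simp add: luk_tnorm_def)
  qed
  then show "\<exists>U V. openin (fuzzy_topology Z N) U \<and> openin (fuzzy_topology Z N) V \<and> x \<in> U \<and> y \<in> V \<and> disjnt U V"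
    using openin_fuzzy_ball[OF N, of _ r 1] fuzzy_ball_centre[OF N, of _ r 1] xy r
    by (intro exI[of _ "fuzzy_ball Z N x r 1"] exI[of _ "fuzzy_ball Z N y r 1"]) auto
qed

text \<open>The identity from the compact space \<open>X\<close> to the Hausdorff fuzzy topology is
  a closed map once it is continuous, so openness of the balls in \<open>X\<close> already forces
  equality.\<close>

lemma fuzzy_topology_eqI:
  assumes N: "fuzzy_metric (topspace X) N" and X: "compact_space X"
    and op: "\<And>x r t. x \<in> topspace X \<Longrightarrow> 0 < t \<Longrightarrow> openin X (fuzzy_ball (topspace X) N x r t)"
  shows "fuzzy_topology (topspace X) N = X"
proof -
  let ?T = "fuzzy_topology (topspace X) N"
  have top: "topspace ?T = topspace X" by (rule topspace_fuzzy_topology[OF N])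
  have le: "openin X U" if "openin ?T U" for U
  proof -
    obtain \<U> where "\<U> \<subseteq> Collect (is_fuzzy_ball (topspace X) N)" "U = \<Union>\<U>"
      using \<open>openin ?T U\<close> unfolding openin_fuzzy_topology[OF N] union_of_def by auto
    then show ?thesis using op by (fastforce simp: is_fuzzy_ball_def intro!: openin_Union)
  qed
  have "continuous_map X ?T id"
    by (auto simp: continuous_map_def top Collect_conj_eq dest!: le)
  then have "closed_map X ?T id"
    by (rule continuous_imp_closed_map[OF _ X Hausdorff_fuzzy_topology[OF N]])
  then have "closedin ?T C" if "closedin X C" for C
    using that by (auto simp: closed_map_def)
  moreover have "closedin X C" if "closedin ?T C" for C
    using that le unfolding closedin_def top by auto
  ultimately have "closedin ?T = closedin X" by blast
  then show ?thesis by (simp add: topology_eq openin_closedin_eq top)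
qed

section \<open>Uniformity on the closed set\<close>

text \<open>The half-line splits at a time \<open>s0\<close> past which \<open>f\<close> stays
  within \<open>e\<close> of its infimum; before it, uniform continuity on a compact interval
  applies.\<close>

lemma antimono_tail_uniform:
  fixes f :: "real \<Rightarrow> real"
  assumes cont: "continuous_on {0<..} f"
    and anti: "\<And>s t. 0 < s \<Longrightarrow> s \<le> t \<Longrightarrow> f t \<le> f s"
    and nonneg: "\<And>t. 0 < t \<Longrightarrow> 0 \<le> f t" and t: "0 < t" and e: "0 < e"
  shows "\<exists>h>0. \<forall>s\<ge>t. f s \<le> f (s + h) + e"
proof -
  let ?L = "Inf (f ` {0<..})"
  have bdd: "bdd_below (f ` {0<..})" using nonneg by (auto intro!: bdd_belowI[of _ 0])
  have "?L < ?L + e" using e by simp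
  then obtain s0 where s0: "s0 > 0" "f s0 < ?L + e"
    using cInf_lessD[of "f ` {0<..}" "?L + e"] by auto
  have L: "?L \<le> f s" if "s > 0" for s using that by (intro cInf_lower bdd) auto
  \<comment> \<open>Ending at \<open>s0 + 1\<close> keeps \<open>s + h\<close> inside the interval
    for \<open>s \<le> s0\<close> and \<open>h \<le> 1\<close>.\<close>
  have "uniformly_continuous_on {t..s0+1} f"
    using t by (intro compact_uniformly_continuous continuous_on_subset[OF cont]) auto
  then obtain \<delta> where \<delta>: "\<delta> > 0"
    "\<And>x y. x \<in> {t..s0+1} \<Longrightarrow> y \<in> {t..s0+1} \<Longrightarrow> dist y x < \<delta> \<Longrightarrow> dist (f y) (f x) < e"
    unfolding uniformly_continuous_on_def using e by metis
  define h where "h = min (\<delta> / 2) 1"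
  have h: "0 < h" "h \<le> 1" "h < \<delta>" using \<delta>(1) by (auto simp: h_def)
  have "f s \<le> f (s + h) + e" if s: "s \<ge> t" for s
  proof (cases "s \<le> s0")
    case True
    then show ?thesis using \<delta>(2)[of s "s + h"] h s by (simp add: dist_real_def)
  next
    case False
    then have "f s \<le> f s0" using anti[of s0 s] s0 by simp
    then show ?thesis using L[of "s + h"] s t h s0 by simp
  qed
  with h(1) show ?thesis by blast
qed

text \<open>A metric inducing the topology is fixed because the moduli of continuity below are
  measured in it.\<close>

locale luk_extension = Metric_space Z \<rho> for Z :: "'a set" and \<rho> +
  fixes Y :: "'a set" and M :: "'a \<Rightarrow> 'a \<Rightarrow> real \<Rightarrow> real"
  assumes compact: "compact_space mtopology"
    and closed: "closedin mtopology Y" and nonempty: "Y \<noteq> {}"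
    and fuzzy: "fuzzy_metric Y M" and gen: "fuzzy_topology Y M = subtopology mtopology Y"
begin

abbreviation d :: "'a \<Rightarrow> 'a \<Rightarrow> real \<Rightarrow> real" where "d x y t \<equiv> 1 - M x y t"

lemma YZ: "x \<in> Y \<Longrightarrow> x \<in> Z"
  using closedin_subset[OF closed] by auto

lemma d_nonneg: "x \<in> Y \<Longrightarrow> y \<in> Y \<Longrightarrow> 0 < t \<Longrightarrow> 0 \<le> d x y t"
  and d_less: "x \<in> Y \<Longrightarrow> y \<in> Y \<Longrightarrow> 0 < t \<Longrightarrow> d x y t < 1"
  and d_eq_0: "x \<in> Y \<Longrightarrow> y \<in> Y \<Longrightarrow> 0 < t \<Longrightarrow> d x y t = 0 \<longleftrightarrow> x = y"
  and d_commute: "x \<in> Y \<Longrightarrow> y \<in> Y \<Longrightarrow> 0 < t \<Longrightarrow> d x y t = d y x t"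
  and d_cont: "x \<in> Y \<Longrightarrow> y \<in> Y \<Longrightarrow> continuous_on {0<..} (d x y)"
  using fuzzy unfolding fuzzy_metric_def by (auto intro!: continuous_intros)

lemma d_triangle:
  assumes "x \<in> Y" "y \<in> Y" "z \<in> Y" "0 < t" "0 < s"
  shows "d x z (t + s) \<le> d x y t + d y z s"
  using fuzzy_metric_triangle[OF fuzzy assms(1-3,5,4)] by (simp add: luk_tnorm_def)

lemma d_antimono: "x \<in> Y \<Longrightarrow> y \<in> Y \<Longrightarrow> 0 < s \<Longrightarrow> s \<le> t \<Longrightarrow> d x y t \<le> d x y s"
  using fuzzy_metric_mono[OF fuzzy] by simp

lemma compact_fuzzy: "compact_space (fuzzy_topology Y M)"
  unfolding gen using closedin_compact_space[OF compact closed] by (rule compact_space_subtopology)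

lemmas topspace_fuzzy = topspace_fuzzy_topology[OF fuzzy]

lemma fuzzy_nbhd:
  assumes "a \<in> Y" "0 < r" "r < 1" "0 < u"
  obtains U where "openin (fuzzy_topology Y M) U" "a \<in> U"
    "\<And>x. x \<in> U \<Longrightarrow> x \<in> Y \<and> d a x u < r \<and> d x a u < r"
proof
  show "openin (fuzzy_topology Y M) (fuzzy_ball Y M a r u)"
    using assms by (intro openin_fuzzy_ball fuzzy)
  show "a \<in> fuzzy_ball Y M a r u"
    using assms by (intro fuzzy_ball_centre fuzzy)
  show "x \<in> Y \<and> d a x u < r \<and> d x a u < r" if "x \<in> fuzzy_ball Y M a r u" for x
    using that assms d_commute[of a x u] by (auto simp: fuzzy_ball_def)
qed

text \<open>Replacing each endpoint costs time \<open>u\<close>. The total time is a separate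
  variable so that the rule matches any way of writing it.\<close>

lemma d_perturb:
  assumes "x \<in> Y" "a \<in> Y" "b \<in> Y" "y \<in> Y" "0 < u" "0 < t" "s = t + 2 * u"
  shows "d x y s \<le> d x a u + d a b t + d b y u"
  using d_triangle[of x a y u "t + u"] d_triangle[of a b y t u] assms by (simp add: algebra_simps)

text \<open>A pair at time \<open>t/2\<close> is strictly below 1, and the two quarters of
  \<open>t\<close> left over allow both endpoints to move. This bound later keeps the extended fuzzy
  metric positive.\<close>

lemma d_bound:
  assumes t: "0 < t"
  shows "\<exists>e>0. \<forall>x\<in>Y. \<forall>y\<in>Y. d x y t \<le> 1 - e"
proof -
  have "\<exists>e>0. \<forall>x\<in>topspace (fuzzy_topology Y M). \<forall>y\<in>topspace (fuzzy_topology Y M). d x y t \<le> 1 - e"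
  proof (rule compact_space_uniform_pairs[OF compact_fuzzy], unfold topspace_fuzzy)
    fix a b assume ab: "a \<in> Y" "b \<in> Y"
    \<comment> \<open>The gap is \<open>3 * e\<close>: each endpoint may use up one third, and one
      third remains.\<close>
    define e where "e = (1 - d a b (t/2)) / 3"
    have e: "0 < e" "e < 1" using d_less[OF ab, of "t/2"] d_nonneg[OF ab, of "t/2"] t by (auto simp: e_def)
    obtain U where U: "openin (fuzzy_topology Y M) U" "a \<in> U"
      "\<And>x. x \<in> U \<Longrightarrow> x \<in> Y \<and> d a x (t/4) < e \<and> d x a (t/4) < e"
      using fuzzy_nbhd[OF ab(1) e, of "t/4"] t by auto
    obtain V where V: "openin (fuzzy_topology Y M) V" "b \<in> V"
      "\<And>x. x \<in> V \<Longrightarrow> x \<in> Y \<and> d b x (t/4) < e \<and> d x b (t/4) < e"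
      using fuzzy_nbhd[OF ab(2) e, of "t/4"] t by auto
    have "d x y t \<le> 1 - e" if xy: "x \<in> U" "y \<in> V" for x y
    proof -
      have "d x y t \<le> d x a (t/4) + d a b (t/2) + d b y (t/4)"
        using U(3)[OF xy(1)] V(3)[OF xy(2)] t ab by (intro d_perturb) auto
      moreover have "d a b (t/2) = 1 - 3 * e" by (simp add: e_def)
      ultimately show ?thesis using U(3)[OF xy(1)] V(3)[OF xy(2)] by linarith
    qed
    then show "\<exists>U V e. openin (fuzzy_topology Y M) U \<and> a \<in> U \<and> openin (fuzzy_topology Y M) V \<and> b \<in> V \<and>
        0 < e \<and> (\<forall>x\<in>U. \<forall>y\<in>V. d x y t \<le> 1 - e)"
      using U(1,2) V(1,2) e(1) by blast
  qed auto
  then show ?thesis unfolding topspace_fuzzy .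
qed

text \<open>For a fixed pair this is \<open>antimono_tail_uniform\<close>; nearby pairs are compared
  with it by moving both endpoints there and back, and compactness finishes.\<close>

lemma d_time_uniform:
  assumes t: "0 < t" and e: "0 < e"
  shows "\<exists>h>0. \<forall>x\<in>Y. \<forall>y\<in>Y. \<forall>s\<ge>t. d x y s \<le> d x y (s + h) + e"
proof -
  \<comment> \<open>Membership in \<open>Y\<close> is part of the predicate because passing to a
    smaller \<open>h\<close> uses \<open>d_antimono\<close>, which is valid only on
    \<open>Y\<close>.\<close>
  have "\<exists>h>0. \<forall>x\<in>topspace (fuzzy_topology Y M). \<forall>y\<in>topspace (fuzzy_topology Y M).
      x \<in> Y \<and> y \<in> Y \<and> (\<forall>s\<ge>t. d x y s \<le> d x y (s + h) + e)"
  proof (rule compact_space_uniform_pairs[OF compact_fuzzy], unfold topspace_fuzzy)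
    fix a b assume ab: "a \<in> Y" "b \<in> Y"
    have "\<exists>h>0. \<forall>s\<ge>t/2. d a b s \<le> d a b (s + h) + e/3"
      using d_cont[OF ab] d_antimono[OF ab] d_nonneg[OF ab] t e
      by (intro antimono_tail_uniform) auto
    then obtain h where h: "h > 0" "\<And>s. s \<ge> t/2 \<Longrightarrow> d a b s \<le> d a b (s + h) + e/3" by blast
    \<comment> \<open>\<open>5 * u \<le> h\<close> gives
      \<open>s + u + 2*u \<le> s - 2*u + h\<close>, and \<open>4 * u \<le> t\<close> gives
      \<open>s - 2*u \<ge> t/2\<close>.\<close>
    define u where "u = min (h/5) (t/4)"
    have u: "0 < u" "5 * u \<le> h" "4 * u \<le> t" using h t by (auto simp: u_def)
    \<comment> \<open>Four endpoint moves cost at most \<open>4 * r \<le> 2 * e / 3\<close>; the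
      change of time takes the remaining third.\<close>
    define r where "r = min (e/6) (1/2)"
    have r: "0 < r" "r < 1" "6 * r \<le> e" using e by (auto simp: r_def)
    obtain U where U: "openin (fuzzy_topology Y M) U" "a \<in> U"
      "\<And>x. x \<in> U \<Longrightarrow> x \<in> Y \<and> d a x u < r \<and> d x a u < r"
      using fuzzy_nbhd[OF ab(1) r(1,2) u(1)] by auto
    obtain V where V: "openin (fuzzy_topology Y M) V" "b \<in> V"
      "\<And>x. x \<in> V \<Longrightarrow> x \<in> Y \<and> d b x u < r \<and> d x b u < r"
      using fuzzy_nbhd[OF ab(2) r(1,2) u(1)] by auto
    have "d x y s \<le> d x y (s + u) + e" if xy: "x \<in> U" "y \<in> V" and s: "s \<ge> t" for x y s
    proof -
      note xU = U(3)[OF xy(1)] and yV = V(3)[OF xy(2)]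
      have "d x y s \<le> d x a u + d a b (s - 2*u) + d b y u"
        using xU yV u s t ab by (intro d_perturb) auto
      moreover have "d a b (s - 2*u) \<le> d a b (s - 2*u + h) + e/3"
        using s u by (intro h(2)) simp
      moreover have "d a b (s - 2*u + h) \<le> d a b (s + u + 2*u)"
        using s u t by (intro d_antimono ab) auto
      moreover have "d a b (s + u + 2*u) \<le> d a x u + d x y (s + u) + d y b u"
        using xU yV u s t ab by (intro d_perturb) auto
      ultimately show ?thesis using xU yV r by linarith
    qed
    then show "\<exists>U V h. openin (fuzzy_topology Y M) U \<and> a \<in> U \<and> openin (fuzzy_topology Y M) V \<and> b \<in> V \<and>
        0 < h \<and> (\<forall>x\<in>U. \<forall>y\<in>V. x \<in> Y \<and> y \<in> Y \<and> (\<forall>s\<ge>t. d x y s \<le> d x y (s + h) + e))"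
      using U V u(1) by (intro exI[of _ U] exI[of _ V] exI[of _ u]) simp
  next
    fix x y h h' assume *: "x \<in> Y \<and> y \<in> Y \<and> (\<forall>s\<ge>t. d x y s \<le> d x y (s + h) + e)"
      and h': "0 < h'" "h' \<le> (h :: real)"
    have "d x y s \<le> d x y (s + h') + e" if "s \<ge> t" for s
      using d_antimono[of x y "s + h'" "s + h"] * h' t that by fastforce
    with * show "x \<in> Y \<and> y \<in> Y \<and> (\<forall>s\<ge>t. d x y s \<le> d x y (s + h') + e)" by blast
  qed
  then show ?thesis unfolding topspace_fuzzy by blast
qed

text \<open>Near a diagonal pair the triangle inequality through the common point gives the bound.
  Near any other pair the points stay apart, so the implication is vacuous for small
  \<open>\<delta>\<close>.\<close>

lemma d_small:
  assumes t: "0 < t" and e: "0 < e"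
  shows "\<exists>\<delta>>0. \<forall>x\<in>Y. \<forall>y\<in>Y. \<rho> x y < \<delta> \<longrightarrow> d x y t \<le> e"
proof -
  have "\<exists>\<delta>>0. \<forall>x\<in>topspace (fuzzy_topology Y M). \<forall>y\<in>topspace (fuzzy_topology Y M). \<rho> x y < \<delta> \<longrightarrow> d x y t \<le> e"
  proof (rule compact_space_uniform_pairs[OF compact_fuzzy], unfold topspace_fuzzy)
    fix a b assume ab: "a \<in> Y" "b \<in> Y"
    show "\<exists>U V \<delta>. openin (fuzzy_topology Y M) U \<and> a \<in> U \<and> openin (fuzzy_topology Y M) V \<and> b \<in> V \<and>
        0 < \<delta> \<and> (\<forall>x\<in>U. \<forall>y\<in>V. \<rho> x y < \<delta> \<longrightarrow> d x y t \<le> e)"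
    proof (cases "a = b")
      case True
      define r where "r = min (e/2) (1/2)"
      have r: "0 < r" "r < 1" "2 * r \<le> e" using e by (auto simp: r_def)
      obtain U where U: "openin (fuzzy_topology Y M) U" "a \<in> U"
        "\<And>x. x \<in> U \<Longrightarrow> x \<in> Y \<and> d a x (t/2) < r \<and> d x a (t/2) < r"
        using fuzzy_nbhd[OF ab(1) r(1,2), of "t/2"] t by auto
      have "d x y t \<le> e" if "x \<in> U" "y \<in> U" for x y
        using d_triangle[of x a y "t/2" "t/2"] U(3)[OF that(1)] U(3)[OF that(2)] ab t r by simp
      then show ?thesis using U True
        by (intro exI[of _ U] exI[of _ U] exI[of _ 1]) auto
    next
      case False
      \<comment> \<open>Two balls of radius one quarter of the distance leave at least
        \<open>2 * \<delta>\<close> between their points.\<close>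
      define \<delta> where "\<delta> = \<rho> a b / 4"
      have \<delta>: "\<delta> > 0" using False ab YZ zero[of a b] nonneg[of a b] by (auto simp: \<delta>_def less_le)
      have op: "openin (fuzzy_topology Y M) (Y \<inter> mball c \<delta>)" for c
        unfolding gen by (simp add: openin_subtopology_Int2)
      have "\<not> \<rho> x y < 2 * \<delta>" if "x \<in> Y \<inter> mball a \<delta>" "y \<in> Y \<inter> mball b \<delta>" for x y
      proof -
        have "\<rho> a b \<le> \<rho> a x + \<rho> x y + \<rho> y b"
          using triangle[of a x b] triangle[of x y b] that ab YZ by fastforce
        moreover have "\<rho> y b = \<rho> b y" by (rule commute)
        moreover have "\<rho> a b = 4 * \<delta>" by (simp add: \<delta>_def)
        ultimately show ?thesis using that by simp
      qed
      then show ?thesis using op \<delta> ab YZ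
        by (intro exI[of _ "Y \<inter> mball a \<delta>"] exI[of _ "Y \<inter> mball b \<delta>"] exI[of _ "2 * \<delta>"]) auto
    qed
  qed auto
  then show ?thesis unfolding topspace_fuzzy .
qed

text \<open>Delaying by \<open>h\<close> costs \<open>e/2\<close> and buys the time \<open>h\<close>
  in which to move from \<open>c\<close> to \<open>b\<close>; thus both sides can be taken at the
  same time \<open>s\<close>.\<close>

lemma d_equicontinuous:
  assumes t: "0 < t" and e: "0 < e"
  shows "\<exists>\<delta>>0. \<forall>a\<in>Y. \<forall>b\<in>Y. \<forall>c\<in>Y. \<forall>s\<ge>t. \<rho> b c < \<delta> \<longrightarrow> d a b s \<le> d a c s + e"
proof -
  obtain h where h: "h > 0" "\<forall>x\<in>Y. \<forall>y\<in>Y. \<forall>s\<ge>t. d x y s \<le> d x y (s + h) + e/2"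
    using d_time_uniform[OF t, of "e/2"] e by auto
  obtain \<delta> where \<delta>: "\<delta> > 0" "\<forall>x\<in>Y. \<forall>y\<in>Y. \<rho> x y < \<delta> \<longrightarrow> d x y h \<le> e/2"
    using d_small[OF h(1), of "e/2"] e by auto
  have "d a b s \<le> d a c s + e" if "a \<in> Y" "b \<in> Y" "c \<in> Y" "s \<ge> t" "\<rho> b c < \<delta>" for a b c s
  proof -
    have "d a b s \<le> d a b (s + h) + e/2" using h(2) that by blast
    moreover have "d a b (s + h) \<le> d a c s + d c b h" using d_triangle[of a c b s h] that t h by simp
    moreover have "d c b h \<le> e/2" using \<delta>(2) that commute[of b c] by simp
    ultimately show ?thesis by simp
  qed
  with \<delta>(1) show ?thesis by blast
qed

section \<open>A time-dependent metric dominating the oscillation\<close>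

text \<open>Suprema over all times \<open>s \<ge> t\<close> make \<open>osc\<close>, and hence \<open>g\<close>, nonincreasing in \<open>t\<close>;
  this is what the triangle inequality of the glued distance needs.\<close>

definition osc :: "real \<Rightarrow> real \<Rightarrow> real"
  where "osc t k = Sup {d a b s - d a c s - k * \<rho> b c | a b c s. a \<in> Y \<and> b \<in> Y \<and> c \<in> Y \<and> t \<le> s}"

lemma osc_upper:
  assumes "0 < t" "0 \<le> k" "a \<in> Y" "b \<in> Y" "c \<in> Y" "t \<le> s"
  shows "d a b s - d a c s - k * \<rho> b c \<le> osc t k"
  unfolding osc_def
proof (rule cSup_upper)
  show "bdd_above {d a b s - d a c s - k * \<rho> b c | a b c s. a \<in> Y \<and> b \<in> Y \<and> c \<in> Y \<and> t \<le> s}"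
  proof (rule bdd_aboveI[of _ 1], clarify)
    fix a b c s assume "a \<in> Y" "b \<in> Y" "c \<in> Y" "t \<le> s"
    moreover have "0 \<le> k * \<rho> b c" using assms(2) by simp
    ultimately show "d a b s - d a c s - k * \<rho> b c \<le> 1"
      using d_less[of a b s] d_nonneg[of a c s] assms(1) by linarith
  qed
qed (use assms in blast)

lemma osc_least:
  assumes "\<And>a b c s. a \<in> Y \<Longrightarrow> b \<in> Y \<Longrightarrow> c \<in> Y \<Longrightarrow> t \<le> s \<Longrightarrow> d a b s - d a c s - k * \<rho> b c \<le> B"
  shows "osc t k \<le> B"
  unfolding osc_def using nonempty by (intro cSup_least) (use assms in \<open>auto, blast\<close>)

lemma osc_nonneg: "0 < t \<Longrightarrow> 0 \<le> k \<Longrightarrow> 0 \<le> osc t k"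
  using nonempty osc_upper[of t k _ _ _ t] YZ by (metis all_not_in_conv diff_self mult_zero_right order_refl zero)

lemma osc_antimono:
  assumes "0 < t" "t \<le> t'" "0 \<le> k" "k \<le> k'"
  shows "osc t' k' \<le> osc t k"
proof (rule osc_least)
  fix a b c s assume *: "a \<in> Y" "b \<in> Y" "c \<in> Y" "t' \<le> s"
  have "k * \<rho> b c \<le> k' * \<rho> b c" using assms by (intro mult_right_mono) auto
  then show "d a b s - d a c s - k' * \<rho> b c \<le> osc t k"
    using osc_upper[of t k a b c s] * assms by simp
qed

text \<open>After a delay \<open>h\<close> the term \<open>d a b\<close> has dropped by at most
  \<open>e\<close>, while the subtracted \<open>d a c\<close> has not grown. The slope
  \<open>k\<close> does not enter, so \<open>h\<close> is uniform in it.\<close>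

lemma osc_time_uniform:
  assumes t: "0 < t" and e: "0 < e"
  shows "\<exists>h>0. \<forall>s\<ge>t. \<forall>k\<ge>0. osc s k \<le> osc (s + h) k + e"
proof -
  obtain h where h: "h > 0" "\<forall>x\<in>Y. \<forall>y\<in>Y. \<forall>s\<ge>t. d x y s \<le> d x y (s + h) + e"
    using d_time_uniform[OF t e] by auto
  have "osc s k \<le> osc (s + h) k + e" if "s \<ge> t" "k \<ge> 0" for s k
  proof (rule osc_least)
    fix a b c s' assume *: "a \<in> Y" "b \<in> Y" "c \<in> Y" "s \<le> s'"
    have "d a b s' \<le> d a b (s' + h) + e" using h(2) * that by auto
    moreover have "d a c (s' + h) \<le> d a c s'" using * that t h by (intro d_antimono) auto
    moreover have "d a b (s' + h) - d a c (s' + h) - k * \<rho> b c \<le> osc (s + h) k"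
      using * that t h by (intro osc_upper) auto
    ultimately show "d a b s' - d a c s' - k * \<rho> b c \<le> osc (s + h) k + e" by linarith
  qed
  with h(1) show ?thesis by blast
qed

text \<open>For slope \<open>1/\<delta>\<close>, equicontinuity handles distances below
  \<open>\<delta>\<close>; beyond that the linear term is at least 1 and outweighs any difference of
  values of \<open>d\<close>.\<close>

lemma osc_small:
  assumes t: "0 < t" and e: "0 < e"
  shows "\<exists>k\<ge>0. osc t k \<le> e"
proof -
  obtain \<delta> where \<delta>: "\<delta> > 0" "\<forall>a\<in>Y. \<forall>b\<in>Y. \<forall>c\<in>Y. \<forall>s\<ge>t. \<rho> b c < \<delta> \<longrightarrow> d a b s \<le> d a c s + e"
    using d_equicontinuous[OF assms] by blast
  have "osc t (1/\<delta>) \<le> e"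
  proof (rule osc_least)
    fix a b c s assume *: "a \<in> Y" "b \<in> Y" "c \<in> Y" "t \<le> s"
    show "d a b s - d a c s - 1/\<delta> * \<rho> b c \<le> e"
    proof (cases "\<rho> b c < \<delta>")
      case True
      then have "d a b s \<le> d a c s + e" using \<delta>(2) * by blast
      moreover have "0 \<le> 1/\<delta> * \<rho> b c" using \<delta>(1) by simp
      ultimately show ?thesis by linarith
    next
      case False
      then have "1 \<le> 1/\<delta> * \<rho> b c" using \<delta>(1) by (simp add: field_simps)
      then show ?thesis using d_less[of a b s] d_nonneg[of a c s] * t e by linarith
    qed
  qed
  then show ?thesis using \<delta>(1) by (intro exI[of _ "1/\<delta>"]) simp
qed

lemma osc_0_less:
  assumes t: "0 < t"
  shows "osc t 0 < 1"
proof -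
  obtain e where e: "e > 0" "\<forall>x\<in>Y. \<forall>y\<in>Y. d x y t \<le> 1 - e" using d_bound[OF t] by blast
  have "osc t 0 \<le> 1 - e"
  proof (rule osc_least)
    fix a b c s assume *: "a \<in> Y" "b \<in> Y" "c \<in> Y" "t \<le> s"
    have "d a b s \<le> d a b t" "d a b t \<le> 1 - e" "0 \<le> d a c s"
      using d_antimono[of a b t s] d_nonneg[of a c s] e(2) * t by auto
    then show "d a b s - d a c s - 0 * \<rho> b c \<le> 1 - e" by simp
  qed
  with e(1) show ?thesis by simp
qed

text \<open>The concave envelope of the modulus of continuity, as the infimum of affine majorants.\<close>

definition env :: "real \<Rightarrow> 'a \<Rightarrow> 'a \<Rightarrow> real"
  where "env t x y = (INF k\<in>{0..}. osc t k + k * \<rho> x y)"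

lemma env_lower: "0 < t \<Longrightarrow> 0 \<le> k \<Longrightarrow> env t x y \<le> osc t k + k * \<rho> x y"
  unfolding env_def
  by (intro cINF_lower bdd_belowI2[of _ 0]) (auto intro!: add_nonneg_nonneg osc_nonneg)

lemma env_greatest: "(\<And>k. 0 \<le> k \<Longrightarrow> B \<le> osc t k + k * \<rho> x y) \<Longrightarrow> B \<le> env t x y"
  unfolding env_def by (intro cINF_greatest) auto

text \<open>Subadditivity of a concave modulus: for slopes \<open>k\<close> and \<open>l\<close> the
  smaller slope serves the composite, since its constant term is one of the two given ones and the
  other is nonnegative.\<close>

lemma env_triangle:
  assumes t: "0 < t" and Z: "x \<in> Z" "y \<in> Z" "z \<in> Z"
  shows "env t x z \<le> env t x y + env t y z"
proof -
  have *: "env t x z \<le> (osc t k + k * \<rho> x y) + (osc t l + l * \<rho> y z)" if "0 \<le> k" "0 \<le> l" for k l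
  proof -
    define m where "m = min k l"
    have m: "0 \<le> m" "m \<le> k" "m \<le> l" using that by (auto simp: m_def)
    have "osc t m \<le> osc t k + osc t l"
      using osc_nonneg[OF t] that by (auto simp: m_def min_def)
    moreover have "m * \<rho> x z \<le> m * \<rho> x y + m * \<rho> y z"
      using mult_left_mono[OF triangle[OF Z] m(1)] by (simp add: distrib_left)
    moreover have "m * \<rho> x y \<le> k * \<rho> x y" "m * \<rho> y z \<le> l * \<rho> y z"
      using m by (auto intro: mult_right_mono)
    ultimately show ?thesis using env_lower[OF t m(1), of x z] by linarith
  qed
  \<comment> \<open>The two infima are handled one after the other, over \<open>k\<close> for fixed
    \<open>l\<close> and then over \<open>l\<close>.\<close>
  have "env t x z - env t x y \<le> osc t l + l * \<rho> y z" if "0 \<le> l" for l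
  proof -
    have "env t x z - (osc t l + l * \<rho> y z) \<le> env t x y"
      using *[OF _ that] by (intro env_greatest) (simp add: algebra_simps)
    then show ?thesis by linarith
  qed
  then have "env t x z - env t x y \<le> env t y z" by (rule env_greatest)
  then show ?thesis by linarith
qed

text \<open>The second argument of the maximum separates points even where \<open>env\<close> vanishes, e.g. when
  \<open>Y\<close> is a singleton.\<close>

definition g :: "real \<Rightarrow> 'a \<Rightarrow> 'a \<Rightarrow> real"
  where "g t x y = max (env t x y) (min (\<rho> x y) (1/2))"

lemma g_nonneg: "0 \<le> g t x y"
  by (simp add: g_def le_max_iff_disj)

text \<open>Slope 0 bounds \<open>env\<close> by \<open>osc t 0\<close>, which is below 1 by
  compactness; the separating term is at most 1/2.\<close>

lemma g_less:
  assumes "0 < t" shows "g t x y < 1"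
  using env_lower[OF assms, of 0 x y] osc_0_less[OF assms] by (auto simp: g_def)

lemma g_commute: "g t x y = g t y x"
  by (simp add: g_def env_def commute)

lemma g_ge: "min (\<rho> x y) (1/2) \<le> g t x y"
  by (simp add: g_def)

lemma g_triangle:
  assumes "0 < t" "x \<in> Z" "y \<in> Z" "z \<in> Z"
  shows "g t x z \<le> g t x y + g t y z"
proof -
  have "min (\<rho> x z) (1/2) \<le> min (\<rho> x y) (1/2) + min (\<rho> y z) (1/2)"
    using triangle[OF assms(2-4)] nonneg[of x y] nonneg[of y z] by linarith
  then show ?thesis using env_triangle[OF assms] by (auto simp: g_def)
qed

lemma g_antimono:
  assumes "0 < t" "t \<le> t'" shows "g t' x y \<le> g t x y"
proof -
  have "env t' x y \<le> osc t k + k * \<rho> x y" if "0 \<le> k" for k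
    using env_lower[of t' k x y] osc_antimono[of t t' k k] assms that by simp
  then have "env t' x y \<le> env t x y" by (rule env_greatest)
  then show ?thesis by (auto simp: g_def)
qed

lemma g_time_uniform:
  assumes t: "0 < t" and e: "0 < e"
  shows "\<exists>h>0. \<forall>s\<ge>t. \<forall>x y. g s x y \<le> g (s + h) x y + e"
proof -
  obtain h where h: "h > 0" "\<forall>s\<ge>t. \<forall>k\<ge>0. osc s k \<le> osc (s + h) k + e"
    using osc_time_uniform[OF assms] by blast
  have "g s x y \<le> g (s + h) x y + e" if s: "s \<ge> t" for s x y
  proof -
    have "env s x y - e \<le> osc (s + h) k + k * \<rho> x y" if "0 \<le> k" for k
    proof -
      have "osc s k \<le> osc (s + h) k + e" using h(2) s that by blast
      then show ?thesis using env_lower[of s k x y] s t that by linarith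
    qed
    then have "env s x y - e \<le> env (s + h) x y" by (rule env_greatest)
    then show ?thesis using e by (auto simp: g_def)
  qed
  with h(1) show ?thesis by blast
qed

lemma g_small:
  assumes t: "0 < t" and e: "0 < e"
  shows "\<exists>\<delta>>0. \<forall>x y. \<rho> x y < \<delta> \<longrightarrow> g t x y < e"
proof -
  obtain k where k: "k \<ge> 0" "osc t k \<le> e/2" using osc_small[OF t, of "e/2"] e by auto
  \<comment> \<open>The bound \<open>e\<close> controls the separating term of \<open>g\<close>;
    \<open>k + 1\<close> avoids division by zero when \<open>k = 0\<close>.\<close>
  define \<delta> where "\<delta> = min e (e / (2 * (k + 1)))"
  have "\<delta> > 0" using e k by (simp add: \<delta>_def)
  moreover have "g t x y < e" if "\<rho> x y < \<delta>" for x y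
  proof -
    have "\<rho> x y < e / (2 * (k + 1))" "\<rho> x y < e" using that by (auto simp: \<delta>_def)
    then have "(k + 1) * \<rho> x y < e/2" using k by (simp add: field_simps)
    then have *: "k * \<rho> x y + \<rho> x y < e/2" by (simp add: algebra_simps)
    have "k * \<rho> x y < e/2" using * nonneg[of x y] by linarith
    then have "env t x y < e" using env_lower[OF t k(1), of x y] k(2) by linarith
    then show ?thesis using \<open>\<rho> x y < e\<close> by (auto simp: g_def)
  qed
  ultimately show ?thesis by blast
qed

lemma g_self:
  assumes "0 < t" "x \<in> Z" shows "g t x x = 0"
proof (rule antisym[OF _ g_nonneg], rule field_le_epsilon)
  fix e :: real assume "0 < e"
  then obtain \<delta> where "\<delta> > 0" "\<forall>x y. \<rho> x y < \<delta> \<longrightarrow> g t x y < e" using g_small[OF assms(1)] by blast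
  then have "g t x x < e" using assms(2) zero[of x x] by simp
  then show "g t x x \<le> 0 + e" by simp
qed

text \<open>Each affine function in the infimum defining \<open>env\<close> dominates this
  difference. This is the Lipschitz property on which the gluing rests.\<close>

lemma d_le_d_plus_g:
  assumes "0 < t" "a \<in> Y" "b \<in> Y" "c \<in> Y"
  shows "d a b t \<le> d a c t + g t b c"
proof -
  have "d a b t - d a c t \<le> osc t k + k * \<rho> b c" if "0 \<le> k" for k
    using osc_upper[of t k a b c t] assms that by simp
  then have "d a b t - d a c t \<le> env t b c" by (rule env_greatest)
  then show ?thesis by (simp add: g_def)
qed

section \<open>The extended distance\<close>

definition ext :: "real \<Rightarrow> 'a \<Rightarrow> 'a \<Rightarrow> real"
  where "ext t x y = min (g t x y) (INF (a, b)\<in>Y \<times> Y. g t x a + d a b t + g t b y)"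

lemma ext_le_g: "ext t x y \<le> g t x y"
  by (simp add: ext_def)

lemma ext_le_via:
  assumes "0 < t" "a \<in> Y" "b \<in> Y"
  shows "ext t x y \<le> g t x a + d a b t + g t b y"
proof -
  have "(INF (a, b)\<in>Y \<times> Y. g t x a + d a b t + g t b y) \<le> (case (a, b) of (a, b) \<Rightarrow> g t x a + d a b t + g t b y)"
    using assms d_nonneg g_nonneg
    by (intro cINF_lower bdd_belowI2[of _ 0]) (auto intro!: add_nonneg_nonneg simp del: diff_ge_0_iff_ge)
  then show ?thesis by (simp add: ext_def)
qed

lemma ext_greatest:
  assumes "B \<le> g t x y" "\<And>a b. a \<in> Y \<Longrightarrow> b \<in> Y \<Longrightarrow> B \<le> g t x a + d a b t + g t b y"
  shows "B \<le> ext t x y"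
  unfolding ext_def using assms nonempty by (auto intro!: cINF_greatest)

lemma ext_nonneg: "0 < t \<Longrightarrow> 0 \<le> ext t x y"
  using d_nonneg g_nonneg by (intro ext_greatest add_nonneg_nonneg) auto

lemma ext_less: "0 < t \<Longrightarrow> ext t x y < 1"
  using ext_le_g g_less by (rule le_less_trans)

lemma ext_self: "0 < t \<Longrightarrow> x \<in> Z \<Longrightarrow> ext t x x = 0"
  using ext_le_g[of t x x] ext_nonneg[of t x x] g_self[of t x] by simp

lemma ext_commute:
  assumes "0 < t" shows "ext t x y = ext t y x"
proof -
  have "ext t x y \<le> ext t y x" for x y
  proof (rule ext_greatest)
    show "ext t x y \<le> g t y x" using ext_le_g[of t x y] by (simp add: g_commute)
    fix a b assume "a \<in> Y" "b \<in> Y"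
    then show "ext t x y \<le> g t y a + d a b t + g t b x"
      using ext_le_via[OF assms, of b a x y] d_commute[of a b t] assms
      by (simp add: g_commute)
  qed
  then show ?thesis by (intro antisym)
qed

text \<open>The detour with \<open>a = x\<close> and \<open>b = y\<close> has vanishing outer legs,
  giving one bound. For the other, the Lipschitz property in each variable shows that no route is
  shorter than \<open>d x y t\<close>.\<close>

lemma ext_eq_d:
  assumes t: "0 < t" and "x \<in> Y" "y \<in> Y"
  shows "ext t x y = d x y t"
proof (rule antisym)
  show "ext t x y \<le> d x y t"
    using ext_le_via[OF assms, of x y] g_self[OF t] YZ assms by simp
  show "d x y t \<le> ext t x y"
  proof (rule ext_greatest)
    show "d x y t \<le> g t x y"
      using d_le_d_plus_g[of t x y x] d_eq_0[of x x t] assms by (simp add: g_commute)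
    fix a b assume ab: "a \<in> Y" "b \<in> Y"
    have "d x y t \<le> d x b t + g t b y" using d_le_d_plus_g[of t x y b] assms ab by (simp add: g_commute)
    moreover have "d b x t \<le> d b a t + g t x a" using d_le_d_plus_g[of t b x a] assms ab by simp
    ultimately show "d x y t \<le> g t x a + d a b t + g t b y"
      using d_commute[of b x t] d_commute[of b a t] assms ab by linarith
  qed
qed

text \<open>This merges two passages through \<open>Y\<close> into one. The time
  \<open>t + s\<close> pays for a single intermediate point, so the gap from \<open>b\<close> to
  \<open>a'\<close> is bridged by the Lipschitz property at the larger of the two times, where
  \<open>g\<close> is smaller.\<close>

lemma d_triangle_via:
  assumes "0 < t" "0 < s" "a \<in> Y" "b \<in> Y" "a' \<in> Y" "b' \<in> Y" "y \<in> Z"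
  shows "d a b' (t + s) \<le> d a b t + g t b y + g s y a' + d a' b' s"
proof (cases "t \<le> s")
  case True
  have "d a b' (t + s) \<le> d a b t + d b b' s" using d_triangle assms by simp
  moreover have "d b b' s \<le> g s b a' + d a' b' s"
    using d_le_d_plus_g[of s b' b a'] d_commute[of b' b s] d_commute[of b' a' s] assms by simp
  moreover have "g s b a' \<le> g s b y + g s y a'" using g_triangle assms YZ by simp
  moreover have "g s b y \<le> g t b y" using g_antimono assms True by simp
  ultimately show ?thesis by linarith
next
  case False
  have "d a b' (t + s) \<le> d a a' t + d a' b' s" using d_triangle assms by simp
  moreover have "d a a' t \<le> d a b t + g t b a'"
    using d_le_d_plus_g[of t a a' b] assms by (simp add: g_commute)
  moreover have "g t b a' \<le> g t b y + g t y a'" using g_triangle assms YZ by simp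
  moreover have "g t y a' \<le> g s y a'" using g_antimono assms False by simp
  ultimately show ?thesis by linarith
qed

text \<open>Each of the two distances is realised either directly or through \<open>Y\<close>, which
  gives four cases. When at most one passes through \<open>Y\<close>, all terms are moved to time
  \<open>t + s\<close> and \<open>g_triangle\<close> applies there; otherwise
  \<open>d_triangle_via\<close> does.\<close>

lemma ext_triangle:
  assumes t: "0 < t" "0 < s" and Z: "x \<in> Z" "y \<in> Z" "z \<in> Z"
  shows "ext (t + s) x z \<le> ext t x y + ext s y z"
proof -
  have t': "0 < t + s" using t by simp
  have gt: "g (t + s) u v \<le> g t u v" and gs: "g (t + s) u v \<le> g s u v" for u v
    using t by (auto intro: g_antimono)
  have dt: "d a b (t + s) \<le> d a b t" and ds: "d a b (t + s) \<le> d a b s" if "a \<in> Y" "b \<in> Y" for a b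
    using t d_antimono[OF that, of t "t + s"] d_antimono[OF that, of s "t + s"] by simp_all
  have tri: "g (t + s) u w \<le> g (t + s) u v + g (t + s) v w" if "u \<in> Z" "v \<in> Z" "w \<in> Z" for u v w
    using g_triangle[OF t'] that .
  have 1: "ext (t + s) x z \<le> g t x y + g s y z"
    using ext_le_g[of "t + s" x z] tri[OF Z] gt[of x y] gs[of y z] by linarith
  have 2: "ext (t + s) x z \<le> g t x y + (g s y a + d a b s + g s b z)" if "a \<in> Y" "b \<in> Y" for a b
    using ext_le_via[OF t' that, of x z] tri[OF Z(1,2) YZ[OF that(1)]] gt[of x y] gs[of y a] gs[of b z]
      ds[OF that] by linarith
  have 3: "ext (t + s) x z \<le> (g t x a + d a b t + g t b y) + g s y z" if "a \<in> Y" "b \<in> Y" for a b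
    using ext_le_via[OF t' that, of x z] tri[OF YZ[OF that(2)] Z(2,3)] gt[of x a] gt[of b y] gs[of y z]
      dt[OF that] by linarith
  have 4: "ext (t + s) x z \<le> (g t x a + d a b t + g t b y) + (g s y a' + d a' b' s + g s b' z)"
    if "a \<in> Y" "b \<in> Y" "a' \<in> Y" "b' \<in> Y" for a b a' b'
    using ext_le_via[OF t' that(1,4), of x z] d_triangle_via[OF t that Z(2)] gt[of x a] gs[of b' z]
    by linarith
  \<comment> \<open>The two summands are unfolded in turn: the outer \<open>ext_greatest\<close>
    treats \<open>ext t x y\<close>, the inner ones \<open>ext s y z\<close>.\<close>
  have "ext (t + s) x z - ext s y z \<le> ext t x y"
  proof (rule ext_greatest)
    have "ext (t + s) x z - g t x y \<le> ext s y z"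
    proof (rule ext_greatest)
      show "ext (t + s) x z - g t x y \<le> g s y z" using 1 by linarith
      show "ext (t + s) x z - g t x y \<le> g s y a + d a b s + g s b z" if "a \<in> Y" "b \<in> Y" for a b
        using 2[OF that] by linarith
    qed
    then show "ext (t + s) x z - ext s y z \<le> g t x y" by linarith
    fix a b assume ab: "a \<in> Y" "b \<in> Y"
    have "ext (t + s) x z - (g t x a + d a b t + g t b y) \<le> ext s y z"
    proof (rule ext_greatest)
      show "ext (t + s) x z - (g t x a + d a b t + g t b y) \<le> g s y z" using 3[OF ab] by linarith
      show "ext (t + s) x z - (g t x a + d a b t + g t b y) \<le> g s y a' + d a' b' s + g s b' z"
        if "a' \<in> Y" "b' \<in> Y" for a' b'
        using 4[OF ab that] by linarith
    qed
    then show "ext (t + s) x z - ext s y z \<le> g t x a + d a b t + g t b y" by linarith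
  qed
  then show ?thesis by linarith
qed

section \<open>Continuity of the extension in time\<close>

lemma ext_antimono:
  assumes "0 < t" "t \<le> s" "x \<in> Z" "y \<in> Z" shows "ext s x y \<le> ext t x y"
proof (cases "t = s")
  case False
  then show ?thesis
    using ext_triangle[of t "s - t" x y y] ext_self[of "s - t" y] assms by simp
qed simp

text \<open>A detour has three summands, each losing at most \<open>e/3\<close> over a delay
  \<open>h\<close> independent of the points \<open>a\<close> and \<open>b\<close>, so the estimate
  survives the infimum.\<close>

lemma ext_time_uniform:
  assumes t: "0 < t" and e: "0 < e"
  shows "\<exists>h>0. \<forall>s\<ge>t. ext s x y \<le> ext (s + h) x y + e"
proof -
  obtain h1 where h1: "h1 > 0" "\<And>s x y. s \<ge> t \<Longrightarrow> g s x y \<le> g (s + h1) x y + e/3"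
    using g_time_uniform[OF t, of "e/3"] e by auto
  obtain h2 where h2: "h2 > 0" "\<And>s x y. s \<ge> t \<Longrightarrow> x \<in> Y \<Longrightarrow> y \<in> Y \<Longrightarrow> d x y s \<le> d x y (s + h2) + e/3"
    using d_time_uniform[OF t, of "e/3"] e by (metis divide_pos_pos zero_less_numeral)
  define h where "h = min h1 h2"
  have h: "0 < h" "h \<le> h1" "h \<le> h2" using h1 h2 by (auto simp: h_def)
  have "ext s x y \<le> ext (s + h) x y + e" if s: "s \<ge> t" for s
  proof -
    have gg: "g s u v \<le> g (s + h) u v + e/3" for u v
      using h1(2)[OF s, of u v] g_antimono[of "s + h" "s + h1" u v] h s t by simp
    have dd: "d u v s \<le> d u v (s + h) + e/3" if "u \<in> Y" "v \<in> Y" for u v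
      using h2(2)[OF s that] d_antimono[OF that, of "s + h" "s + h2"] h s t by simp
    have "ext s x y - e \<le> ext (s + h) x y"
    proof (rule ext_greatest)
      show "ext s x y - e \<le> g (s + h) x y" using ext_le_g[of s x y] gg[of x y] e by linarith
      fix a b assume ab: "a \<in> Y" "b \<in> Y"
      show "ext s x y - e \<le> g (s + h) x a + d a b (s + h) + g (s + h) b y"
        using ext_le_via[OF _ ab, of s x y] gg[of x a] gg[of b y] dd[OF ab] s t by linarith
    qed
    then show ?thesis by linarith
  qed
  with h(1) show ?thesis by blast
qed

lemma ext_continuous_time:
  assumes Z: "x \<in> Z" "y \<in> Z"
  shows "continuous_on {0<..} (\<lambda>t. ext t x y)"
  unfolding continuous_on_iff
proof (intro ballI allI impI)
  fix t e :: real assume "t \<in> {0<..}" and e: "0 < e"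
  then have t: "0 < t" by simp
  \<comment> \<open>Starting at \<open>t/2\<close> lets the same \<open>h\<close> serve times on
    both sides of \<open>t\<close>.\<close>
  obtain h where h: "h > 0" "\<And>s. s \<ge> t/2 \<Longrightarrow> ext s x y \<le> ext (s + h) x y + e/2"
    using ext_time_uniform[of "t/2" "e/2" x y] t e by auto
  define \<delta> where "\<delta> = min (t/2) h"
  have \<delta>: "0 < \<delta>" "\<delta> \<le> t/2" "\<delta> \<le> h" using h t by (auto simp: \<delta>_def)
  have *: "\<bar>ext u x y - ext v x y\<bar> < e" if "t/2 \<le> u" "u \<le> v" "v \<le> u + h" for u v
    using h(2)[OF that(1)] ext_antimono[of u v x y] ext_antimono[of v "u + h" x y] that t e Z by auto
  have "dist (ext s x y) (ext t x y) < e" if "s \<in> {0<..}" "dist s t < \<delta>" for s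
    using *[of s t] *[of t s] that \<delta> unfolding dist_real_def by (cases "s \<le> t") (auto simp: abs_if split: if_splits)
  with \<delta>(1) show "\<exists>\<delta>>0. \<forall>s\<in>{0<..}. dist s t < \<delta> \<longrightarrow> dist (ext s x y) (ext t x y) < e" by blast
qed

section \<open>Separation of points\<close>

text \<open>As \<open>Y\<close> is closed, a ball around \<open>x\<close> misses it, and
  \<open>g\<close> dominates the truncated metric.\<close>

lemma g_away_from_Y:
  assumes t: "0 < t" and x: "x \<in> Z" "x \<notin> Y"
  shows "\<exists>e>0. \<forall>a\<in>Y. e \<le> g t x a"
proof -
  obtain r where r: "r > 0" "disjnt Y (mball x r)"
    using closed x unfolding closedin_metric by auto
  have "min r (1/2) \<le> g t x a" if a: "a \<in> Y" for a
  proof -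
    have "r \<le> \<rho> x a" using r(2) a x YZ by (force simp: disjnt_iff)
    then show ?thesis using g_ge[of x a t] by linarith
  qed
  then show ?thesis using r(1) by (intro exI[of _ "min r (1/2)"]) auto
qed

text \<open>The direct route is positive by separation, and every detour begins with a leg from
  \<open>x\<close> to \<open>Y\<close> of length at least \<open>e\<close>.\<close>

lemma ext_pos_off_Y:
  assumes t: "0 < t" and xy: "x \<in> Z" "y \<in> Z" "x \<noteq> y" and x: "x \<notin> Y"
  shows "0 < ext t x y"
proof -
  obtain e where e: "e > 0" "\<forall>a\<in>Y. e \<le> g t x a" using g_away_from_Y[OF t xy(1) x] by blast
  have "0 < \<rho> x y" using xy zero[of x y] nonneg[of x y] by (simp add: less_le)
  then have g: "0 < g t x y" using g_ge[of x y t] by linarith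
  have "min e (g t x y) \<le> ext t x y"
  proof (rule ext_greatest)
    fix a b assume ab: "a \<in> Y" "b \<in> Y"
    show "min e (g t x y) \<le> g t x a + d a b t + g t b y"
      using e(2) ab d_nonneg[OF ab t] g_nonneg[of t b y] by fastforce
  qed simp
  then show ?thesis using e(1) g by linarith
qed

lemma ext_eq_0:
  assumes t: "0 < t" and xy: "x \<in> Z" "y \<in> Z"
  shows "ext t x y = 0 \<longleftrightarrow> x = y"
proof
  assume 0: "ext t x y = 0"
  show "x = y"
  proof (rule ccontr)
    assume ne: "x \<noteq> y"
    then have "x \<in> Y" "y \<in> Y"
      using ext_pos_off_Y[OF t xy] ext_pos_off_Y[OF t xy(2,1)] 0 ext_commute[OF t, of x y] by auto
    then show False using ext_eq_d[OF t] d_eq_0[OF _ _ t] 0 ne by metis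
  qed
qed (use ext_self t xy in auto)

section \<open>The extension generates the given topology\<close>

text \<open>Only the last leg of a route changes, so the endpoint moves without any change of time;
  openness of the balls follows from this.\<close>

lemma ext_le_ext_plus_g:
  assumes t: "0 < t" and Z: "x \<in> Z" "y \<in> Z" "z \<in> Z"
  shows "ext t x z \<le> ext t x y + g t y z"
proof -
  have "ext t x z - g t y z \<le> ext t x y"
  proof (rule ext_greatest)
    show "ext t x z - g t y z \<le> g t x y" using ext_le_g[of t x z] g_triangle[OF t Z] by linarith
    fix a b assume ab: "a \<in> Y" "b \<in> Y"
    show "ext t x z - g t y z \<le> g t x a + d a b t + g t b y"
      using ext_le_via[OF t ab, of x z] g_triangle[OF t YZ[OF ab(2)] Z(2,3)] by linarith
  qed
  then show ?thesis by linarith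
qed

lemma fuzzy_metric_ext: "fuzzy_metric Z (\<lambda>x y t. 1 - ext t x y)"
  unfolding fuzzy_metric_def
proof (intro conjI ballI allI impI)
  fix x y z :: 'a and s t :: real
  assume "x \<in> Z" "y \<in> Z" "z \<in> Z" "0 < s" "0 < t"
  \<comment> \<open>The t-norm is a maximum: its first argument is bounded by the triangle
    inequality, its argument 0 by \<open>ext < 1\<close>.\<close>
  then show "luk_tnorm (1 - ext t x y) (1 - ext s y z) \<le> 1 - ext (t + s) x z"
    using ext_triangle[of t s x y z] ext_less[of "t + s" x z] by (simp add: luk_tnorm_def)
next
  fix x y :: 'a assume "x \<in> Z" "y \<in> Z"
  then show "continuous_on {0<..} (\<lambda>t. 1 - ext t x y)"
    by (intro continuous_intros ext_continuous_time)
qed (use ext_nonneg ext_less ext_eq_0 ext_commute in \<open>auto intro: less_imp_le\<close>)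

lemma openin_fuzzy_ball_ext:
  assumes x: "x \<in> Z" and t: "0 < t"
  shows "openin mtopology (fuzzy_ball Z (\<lambda>x y t. 1 - ext t x y) x r t)"
  unfolding openin_mtopology
proof (intro conjI allI impI)
  fix y assume "y \<in> fuzzy_ball Z (\<lambda>x y t. 1 - ext t x y) x r t"
  then have y: "y \<in> Z" "ext t x y < r" by (auto simp: fuzzy_ball_def)
  \<comment> \<open>The slack \<open>r - ext t x y\<close> is what moving \<open>y\<close> within
    \<open>mball y \<delta>\<close> may use up.\<close>
  obtain \<delta> where \<delta>: "\<delta> > 0" "\<And>u v. \<rho> u v < \<delta> \<Longrightarrow> g t u v < r - ext t x y"
    using g_small[OF t, of "r - ext t x y"] y by auto
  have "ext t x z < r" if "z \<in> mball y \<delta>" for z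
    using ext_le_ext_plus_g[OF t x y(1), of z] \<delta>(2)[of y z] that by simp
  then show "\<exists>\<delta>>0. mball y \<delta> \<subseteq> fuzzy_ball Z (\<lambda>x y t. 1 - ext t x y) x r t"
    using \<delta>(1) by (intro exI[of _ \<delta>]) (auto simp: fuzzy_ball_def)
qed (auto simp: fuzzy_ball_def)

lemma fuzzy_topology_ext: "fuzzy_topology Z (\<lambda>x y t. 1 - ext t x y) = mtopology"
  using fuzzy_topology_eqI[of mtopology] fuzzy_metric_ext compact openin_fuzzy_ball_ext by simp

end

theorem theorem4p1:
  fixes X :: "'a topology" and Y :: "'a set" and M :: "'a \<Rightarrow> 'a \<Rightarrow> real \<Rightarrow> real"
  assumes "compact_space X" and "metrizable_space X"
    and "closedin X Y" and "Y \<noteq> {}"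
    and "fuzzy_metric Y M" and "fuzzy_topology Y M = subtopology X Y"
  shows "\<exists>M' :: 'a \<Rightarrow> 'a \<Rightarrow> real \<Rightarrow> real.
    fuzzy_metric (topspace X) M' \<and> fuzzy_topology (topspace X) M' = X \<and>
    (\<forall>x\<in>Y. \<forall>y\<in>Y. \<forall>t>0. M' x y t = M x y t)"
proof -
  obtain Z \<rho> where Z: "Metric_space Z \<rho>" and X: "X = Metric_space.mtopology Z \<rho>"
    using assms(2) unfolding metrizable_space_def by blast
  interpret Metric_space Z \<rho> by (rule Z)
  interpret luk_extension Z \<rho> Y M
    by unfold_locales (use assms in \<open>simp_all add: X\<close>)
  show ?thesis
    unfolding X topspace_mtopology
    using fuzzy_metric_ext fuzzy_topology_ext ext_eq_d
    by (intro exI[of _ "\<lambda>x y t. 1 - ext t x y"]) simp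
qed

end
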